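(* Let $S$ be an inverse semigroup with set of idempotents $E$. The following statements are equivalent: (1) $S$ is quasi-countable, i.e. there is a countable subset $F \subset S$ such that $S = \langle F \cup E\rangle$; (2) $S$ admits a proper and right subinvariant uniformly discrete extended metric whose components are exactly the $\mathcal{L}$-classes of $S$. Moreover, such a metric is unique up to bijective coarse equivalence.
   Context: An inverse semigroup is a semigroup $S$ in which every $s\in S$ has a unique element $s^*$ with $ss^*s=s$ and $s^*ss^*=s^*$. $E$ is the set of idempotents of $S$. $\langle A\rangle$ is the inverse subsemigroup generated by $A$. Green's relation $\mathcal L$: $s\mathrel{\mathcal L}t$ iff $s^*s=t^*t$ (equivalently $s,t$ can be multiplied into each other on the left); its classes are the $\mathcal L$-classes. An extended metric on $X$ is a function $d\colon X\times X\to[0,\infty]$ satisfying the usual metric axioms but allowed to take the value $\infty$; its components are the equivalence classes of the relation $d(x,y)<\infty$. It is uniformly discrete if there is $c>0$ with $d(x,y)>c$ for all $x\ne y$. An extended metric $d$ on $S$ (uniformly discrete with components the $\mathcal L$-classes) is right subinvariant if $d(sx,tx)\le d(s,t)$ for all $s,t,x\in S$; it is proper if for every $r\ge 0$ there is a finite set $F\subset S$ such that $y\in Fx$ for all $x,y\in S$ with $x\neq y$ and $d(x,y)\le r$. A map $f\colon X\to Y$ of extended metric spaces is a coarse embedding if there are non-decreasing functions $\rho_-,\rho_+\colon[0,\infty]\to[0,\infty]$ with $\rho_+^{-1}(\infty)=\{\infty\}$, $\rho_-(r)\to\infty$ as $r\to\infty$, and $\rho_-(d_X(x,y))\le d_Y(f(x),f(y))\le\rho_+(d_X(x,y))$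 for all $x,y\in X$; it is a coarse equivalence if moreover for some $k\ge0$ the $k$-neighbourhood of $f(X)$ is $Y$. A bijective coarse equivalence is a coarse equivalence that is a bijection. Uniqueness means: for any two such metrics $d,d'$ on $S$ there is a bijective coarse equivalence $(S,d)\to(S,d')$. *)

theory Defs
  imports Complex_Main "HOL-Library.Countable_Set" "HOL-Library.Extended_Nonnegative_Real"
begin

section \<open>Inverse semigroups\<close>

class inverse_semigroup = semigroup_mult +
  assumes ex1_inverse: "\<exists>!t. s * t * s = s \<and> t * s * t = t"

definition star :: "'a::inverse_semigroup \<Rightarrow> 'a"
  where "star s = (THE t. s * t * s = s \<and> t * s * t = t)"

definition idempotents :: "'a::inverse_semigroup set"
  where "idempotents = {e. e * e = e}"

definition inverse_subsemigroup :: "'a::inverse_semigroup set \<Rightarrow> bool"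
  where "inverse_subsemigroup T \<longleftrightarrow> (\<forall>s\<in>T. \<forall>t\<in>T. s * t \<in> T) \<and> (\<forall>s\<in>T. star s \<in> T)"

definition generated :: "'a::inverse_semigroup set \<Rightarrow> 'a set"
  where "generated A = inverse_subsemigroup hull A"

definition green_L :: "('a::inverse_semigroup \<times> 'a) set"
  where "green_L = {(s, t). star s * s = star t * t}"

definition L_classes :: "'a::inverse_semigroup set set"
  where "L_classes = UNIV // green_L"

definition quasi_countable :: "'a::inverse_semigroup itself \<Rightarrow> bool"
  where "quasi_countable _ \<longleftrightarrow>
    (\<exists>F :: 'a set. countable F \<and> generated (F \<union> idempotents) = UNIV)"


section \<open>Extended metrics\<close>

definition extended_metric :: "('a \<Rightarrow> 'a \<Rightarrow> ennreal) \<Rightarrow> bool"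
  where "extended_metric d \<longleftrightarrow>
    (\<forall>x y. d x y = 0 \<longleftrightarrow> x = y) \<and>
    (\<forall>x y. d x y = d y x) \<and>
    (\<forall>x y z. d x z \<le> d x y + d y z)"

definition components :: "('a \<Rightarrow> 'a \<Rightarrow> ennreal) \<Rightarrow> 'a set set"
  where "components d = UNIV // {(x, y). d x y < \<infinity>}"

definition uniformly_discrete :: "('a \<Rightarrow> 'a \<Rightarrow> ennreal) \<Rightarrow> bool"
  where "uniformly_discrete d \<longleftrightarrow> (\<exists>c::real. c > 0 \<and> (\<forall>x y. x \<noteq> y \<longrightarrow> d x y > ennreal c))"

definition right_subinvariant :: "('a::inverse_semigroup \<Rightarrow> 'a \<Rightarrow> ennreal) \<Rightarrow> bool"
  where "right_subinvariant d \<longleftrightarrow> (\<forall>s t x. d (s * x) (t * x) \<le> d s t)"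

definition proper_metric :: "('a::inverse_semigroup \<Rightarrow> 'a \<Rightarrow> ennreal) \<Rightarrow> bool"
  where "proper_metric d \<longleftrightarrow>
    (\<forall>r::real. r \<ge> 0 \<longrightarrow>
      (\<exists>F. finite F \<and> (\<forall>x y. x \<noteq> y \<and> d x y \<le> ennreal r \<longrightarrow> y \<in> (\<lambda>f. f * x) ` F)))"

definition admissible_metric :: "('a::inverse_semigroup \<Rightarrow> 'a \<Rightarrow> ennreal) \<Rightarrow> bool"
  where "admissible_metric d \<longleftrightarrow>
    extended_metric d \<and> uniformly_discrete d \<and> components d = L_classes \<and>
    right_subinvariant d \<and> proper_metric d"


section \<open>Coarse maps\<close>

text \<open>The limit of the lower control function is taken along finite \<open>r\<close>: on \<^typ>\<open>ennreal\<close>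
  itself the filter \<^term>\<open>at_top\<close> is principal at \<open>\<infinity>\<close> and would only constrain the
  value there.\<close>

definition coarse_embedding ::
    "('a \<Rightarrow> 'a \<Rightarrow> ennreal) \<Rightarrow> ('b \<Rightarrow> 'b \<Rightarrow> ennreal) \<Rightarrow> ('a \<Rightarrow> 'b) \<Rightarrow> bool"
  where "coarse_embedding dX dY f \<longleftrightarrow>
    (\<exists>\<rho>\<^sub>m \<rho>\<^sub>p :: ennreal \<Rightarrow> ennreal.
      mono \<rho>\<^sub>m \<and> mono \<rho>\<^sub>p \<and>
      \<rho>\<^sub>p -` {\<infinity>} = {\<infinity>} \<and>
      ((\<lambda>r::real. \<rho>\<^sub>m (ennreal r)) \<longlongrightarrow> \<infinity>) at_top \<and>
      (\<forall>x y. \<rho>\<^sub>m (dX x y) \<le> dY (f x) (f y) \<and> dY (f x) (f y) \<le> \<rho>\<^sub>p (dX x y)))"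

definition neighbourhood :: "('a \<Rightarrow> 'a \<Rightarrow> ennreal) \<Rightarrow> real \<Rightarrow> 'a set \<Rightarrow> 'a set"
  where "neighbourhood d k A = {y. \<exists>a\<in>A. d a y \<le> ennreal k}"

definition coarse_equivalence ::
    "('a \<Rightarrow> 'a \<Rightarrow> ennreal) \<Rightarrow> ('b \<Rightarrow> 'b \<Rightarrow> ennreal) \<Rightarrow> ('a \<Rightarrow> 'b) \<Rightarrow> bool"
  where "coarse_equivalence dX dY f \<longleftrightarrow>
    coarse_embedding dX dY f \<and> (\<exists>k::real. k \<ge> 0 \<and> neighbourhood dY k (range f) = UNIV)"

definition bijective_coarse_equivalence ::
    "('a \<Rightarrow> 'a \<Rightarrow> ennreal) \<Rightarrow> ('b \<Rightarrow> 'b \<Rightarrow> ennreal) \<Rightarrow> ('a \<Rightarrow> 'b) \<Rightarrow> bool"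
  where "bijective_coarse_equivalence dX dY f \<longleftrightarrow> coarse_equivalence dX dY f \<and> bij f"

end

(* From a countable F with S = <F \<union> E> one builds a weighted graph on S: x is joined to g x, for g in F
   with g* g x = x, by an edge of length 1 + (index of g), and d is the path metric.  If x and u x
   are L-related and u is a product of generators, then all partial products applied to x
   stay in the same L-class, and the factors from E act trivially; hence the components are the
   L-classes.  Conversely s = f (s* s) for some f from one of the countably many finite sets given by
   properness, because s and s* s are L-related.  For uniqueness the identity map works: if y = f x
   is L-related to x, then x = f* f x, so d'(x, y) \<le> d'(f* f, f) < \<infinity>, and there are only
   finitely many such f for d(x, y) \<le> r. *)
theory Submission
  imports Defs
begin

section \<open>Inverse semigroups\<close>

lemma star_inverse:
  fixes s :: "'a::inverse_semigroup"
  shows "s * star s * s = s" "star s * s * star s = star s"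
  using theI'[OF ex1_inverse[of s]] unfolding star_def by blast+

lemma star_unique:
  fixes s :: "'a::inverse_semigroup"
  assumes "s * t * s = s" "t * s * t = t"
  shows "star s = t"
  using ex1_inverse[of s] star_inverse[of s] assms by blast

text \<open>Right-nested forms, the last two with a trailing factor, so that they rewrite inside
  products normalised by \<open>mult.assoc\<close>.\<close>

lemma star_inverse_assoc:
  fixes s :: "'a::inverse_semigroup"
  shows "s * (star s * s) = s" "star s * (s * star s) = star s"
    "s * (star s * (s * x)) = s * x" "star s * (s * (star s * x)) = star s * x"
  using star_inverse[of s] by (metis mult.assoc)+

lemma star_star [simp]: "star (star s) = (s::'a::inverse_semigroup)"
  by (rule star_unique) (simp_all add: star_inverse)

lemma star_idempotent:
  fixes e :: "'a::inverse_semigroup"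
  assumes "e * e = e"
  shows "star e = e"
  by (rule star_unique) (simp_all add: assms)

text \<open>If \<open>x\<close> is the inverse of \<open>e * f\<close>, then
  \<open>f * x * e\<close> is an inverse as well, so both agree. This form makes \<open>x\<close>
  idempotent, hence its own inverse, and \<open>e * f = star x = x\<close>.\<close>

lemma idempotent_mult:
  fixes e f :: "'a::inverse_semigroup"
  assumes e: "e * e = e" and f: "f * f = f"
  shows "(e * f) * (e * f) = e * f"
proof -
  define x where "x = star (e * f)"
  have e': "e * (e * z) = e * z" and f': "f * (f * z) = f * z" for z
    using e f by (metis mult.assoc)+
  have 1: "e * (f * (x * (e * f))) = e * f" and 2: "x * (e * (f * x)) = x"
    using star_inverse[of "e * f"] by (simp_all add: x_def mult.assoc)
  have 4: "x * (e * (f * (x * z))) = x * z" for z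
    using 2 by (metis mult.assoc)
  have "star (e * f) = f * x * e"
    by (rule star_unique) (simp_all add: mult.assoc e e' f' 1 4)
  then have x: "x = f * x * e"
    by (simp add: x_def)
  have "x * x = (f * x * e) * (f * x * e)"
    by (simp only: x[symmetric])
  also have "\<dots> = f * x * e"
    by (simp add: mult.assoc 4)
  also have "\<dots> = x"
    by (rule x[symmetric])
  finally have xx: "x * x = x" .
  have "star x = e * f"
    by (simp add: x_def)
  then show ?thesis
    using xx star_idempotent[OF xx] by simp
qed

text \<open>Both products are idempotent. Hence \<open>f * e\<close> is an inverse of
  \<open>e * f\<close>, and so is \<open>e * f\<close> itself; inverses are unique.\<close>

lemma idempotents_commute:
  fixes e f :: "'a::inverse_semigroup"
  assumes e: "e * e = e" and f: "f * f = f"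
  shows "e * f = f * e"
proof -
  have e': "e * (e * z) = e * z" and f': "f * (f * z) = f * z" for z
    using e f by (metis mult.assoc)+
  have ef: "e * (f * (e * f)) = e * f" and fe: "f * (e * (f * e)) = f * e"
    using idempotent_mult[OF e f] idempotent_mult[OF f e] by (simp_all add: mult.assoc)
  have "star (e * f) = f * e"
    by (rule star_unique) (simp_all add: mult.assoc e' f' ef fe)
  moreover have "star (e * f) = e * f"
    by (rule star_idempotent[OF idempotent_mult[OF e f]])
  ultimately show ?thesis by simp
qed

lemma idempotent_star_mult:
  fixes s :: "'a::inverse_semigroup"
  shows "(star s * s) * (star s * s) = star s * s" "(s * star s) * (s * star s) = s * star s"
  by (simp_all add: mult.assoc star_inverse_assoc)

text \<open>The idempotents \<open>t * star t\<close> and \<open>star s * s\<close> commute, which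
  verifies both defining equations of the inverse.\<close>

lemma star_mult: "star (s * t) = star t * star (s::'a::inverse_semigroup)"
proof -
  have c: "t * (star t * (star s * (s * z))) = star s * (s * (t * (star t * z)))" for z
    using arg_cong[OF idempotents_commute[OF idempotent_star_mult(2)[of t]
          idempotent_star_mult(1)[of s]], of "\<lambda>w. w * z"]
    by (simp add: mult.assoc)
  show ?thesis
  proof (rule star_unique)
    show "s * t * (star t * star s) * (s * t) = s * t"
      by (simp add: mult.assoc c star_inverse_assoc)
    show "star t * star s * (s * t) * (star t * star s) = star t * star s"
      by (simp add: mult.assoc c[symmetric] star_inverse_assoc)
  qed
qed

section \<open>Green's relation and generated inverse subsemigroups\<close>

text \<open>Multiplying \<open>star x * star f * f * x = star x * x\<close> by \<open>x\<close> on
  the left and commuting the idempotents \<open>x * star x\<close> and \<open>star f * f\<close>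
  gives \<open>star f * f * x = x\<close>. The right side serves as the edge condition for
  paths.\<close>

lemma green_L_mult_left_iff:
  fixes f x :: "'a::inverse_semigroup"
  shows "(f * x, x) \<in> green_L \<longleftrightarrow> star f * f * x = x"
proof
  assume "(f * x, x) \<in> green_L"
  then have "star x * (star f * (f * x)) = star x * x"
    by (simp add: green_L_def star_mult mult.assoc)
  then have "x * (star x * (star f * (f * x))) = x * (star x * x)"
    by simp
  then have "x = x * star x * (star f * f) * x"
    by (simp add: mult.assoc star_inverse_assoc)
  also have "x * star x * (star f * f) = star f * f * (x * star x)"
    by (intro idempotents_commute idempotent_star_mult)
  finally show "star f * f * x = x"
    by (simp add: mult.assoc star_inverse_assoc)
next
  assume "star f * f * x = x"
  then show "(f * x, x) \<in> green_L"
    by (simp add: green_L_def star_mult mult.assoc)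
qed

lemma equiv_green_L: "equiv UNIV (green_L :: ('a::inverse_semigroup \<times> 'a) set)"
  by (auto simp: green_L_def equiv_def refl_on_def sym_def trans_def)

lemma green_L_star_mult: "(star s * s, s) \<in> green_L" for s :: "'a::inverse_semigroup"
  by (simp add: green_L_def star_mult mult.assoc star_inverse_assoc)

lemma generated_induct [consumes 1, case_names base mult star]:
  fixes u :: "'a::inverse_semigroup"
  assumes "u \<in> generated A"
    and "\<And>a. a \<in> A \<Longrightarrow> P a"
    and "\<And>s t. P s \<Longrightarrow> P t \<Longrightarrow> P (s * t)"
    and "\<And>s. P s \<Longrightarrow> P (star s)"
  shows "P u"
proof -
  have "generated A \<subseteq> {u. P u}"
    unfolding generated_def
    by (rule hull_minimal) (use assms in \<open>auto simp: inverse_subsemigroup_def\<close>)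
  with assms(1) show ?thesis by auto
qed

lemma generated_superset: "A \<subseteq> generated (A :: 'a::inverse_semigroup set)"
  unfolding generated_def by (rule hull_subset)

lemma generated_mult:
  fixes s t :: "'a::inverse_semigroup"
  assumes "s \<in> generated A" "t \<in> generated A"
  shows "s * t \<in> generated A"
  using assms by (auto simp: generated_def hull_def inverse_subsemigroup_def)


section \<open>The path metric of a generating set\<close>

text \<open>The number is the total length. \<open>Suc\<close> makes each edge at least 1 long, and
  for countable \<open>F\<close> the injectivity of \<open>to_nat_on F\<close> leaves finitely many
  generators below each length. The condition on \<open>star g * g\<close> keeps an edge inside one
  L-class.\<close>

inductive path :: "'a::inverse_semigroup set \<Rightarrow> nat \<Rightarrow> 'a \<Rightarrow> 'a \<Rightarrow> bool" for F
  where
    path_refl: "path F 0 x x"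
  | path_step: "path F n x y \<Longrightarrow> g \<in> F \<Longrightarrow> star g * g * y = y
      \<Longrightarrow> path F (n + Suc (to_nat_on F g)) x (g * y)"
  | path_back: "path F n x (g * y) \<Longrightarrow> g \<in> F \<Longrightarrow> star g * g * y = y
      \<Longrightarrow> path F (n + Suc (to_nat_on F g)) x y"

text \<open>Paths grow at their endpoint, so the induction runs over the second leg; it is therefore
  the first premise.\<close>

lemma path_trans:
  assumes "path F n y z" "path F m x y"
  shows "path F (m + n) x z"
  using assms
proof (induction rule: path.induct)
  case (path_refl y)
  then show ?case by simp
next
  case (path_step n x y g)
  then show ?case using path.path_step[of F "m + n" _ y g] by (simp add: add.assoc)
next
  case (path_back n x g y)
  then show ?case using path.path_back[of F "m + n" _ g y] by (simp add: add.assoc)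
qed

lemma path_sym:
  assumes "path F n x y"
  shows "path F n y x"
  using assms
proof (induction rule: path.induct)
  case (path_refl x)
  then show ?case by (rule path.path_refl)
next
  case (path_step n x y g)
  have "path F (0 + Suc (to_nat_on F g)) (g * y) y"
    using path_step by (intro path.path_back path.path_refl) auto
  from path_trans[OF path_step.IH this] show ?case by (simp add: add.commute)
next
  case (path_back n x g y)
  have "path F (0 + Suc (to_nat_on F g)) y (g * y)"
    using path_back by (intro path.path_step path.path_refl) auto
  from path_trans[OF path_back.IH this] show ?case by (simp add: add.commute)
qed

text \<open>Edges multiply on the left, so right multiplication by \<open>z\<close> preserves them
  with their lengths. Right subinvariance of the distance comes from this.\<close>

lemma path_mult_right:
  assumes "path F n x y"
  shows "path F n (x * z) (y * z)"
  using assms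
proof (induction rule: path.induct)
  case (path_refl x)
  then show ?case by (rule path.path_refl)
next
  case (path_step n x y g)
  then show ?case using path.path_step[of F n "x * z" "y * z" g]
    by (simp add: mult.assoc[symmetric])
next
  case (path_back n x g y)
  then show ?case using path.path_back[of F n "x * z" g "y * z"]
    by (simp add: mult.assoc[symmetric])
qed

lemma path_0_eq:
  assumes "path F 0 x y"
  shows "x = y"
  using assms by cases auto

lemma path_green_L:
  assumes "path F n x y"
  shows "(x, y) \<in> green_L"
  using assms
proof (induction rule: path.induct)
  case (path_refl x)
  then show ?case by (simp add: green_L_def)
next
  case (path_step n x y g)
  then show ?case using green_L_mult_left_iff[of g y] by (simp add: green_L_def)
next
  case (path_back n x g y)
  then show ?case using green_L_mult_left_iff[of g y] by (simp add: green_L_def)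
qed

text \<open>The hypothesis on \<open>s\<close> says that \<open>u * s\<close> and \<open>s\<close>
  are L-related. The induction keeps \<open>s\<close> arbitrary, because in a product the left
  factor starts from another point than the right one.\<close>

lemma path_generated:
  fixes F :: "'a::inverse_semigroup set"
  assumes "u \<in> generated (F \<union> idempotents)" "star u * u * s = s"
  shows "\<exists>n. path F n s (u * s)"
  using assms
proof (induction arbitrary: s rule: generated_induct)
  case (base a)
  show ?case
  proof (cases "a \<in> F")
    case True
    then show ?thesis using path_step[OF path_refl True base(2)] by blast
  next
    case False
    then have a: "a * a = a"
      using base by (auto simp: idempotents_def)
    then have "a * s = s"
      using base(2) by (simp add: star_idempotent)
    then show ?thesis using path_refl[of F s] by auto
  qed
next
  case (mult u v)
  have s: "star v * (star u * (u * (v * s))) = s"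
    using mult.prems by (simp add: star_mult mult.assoc)
  \<comment> \<open>By the preceding equation \<open>s\<close> begins with \<open>star v\<close>,
    which \<open>star v * v\<close> fixes from the left.\<close>
  have v: "star v * v * s = s"
    by (metis s mult.assoc star_inverse_assoc(4))
  have "(u * v * s, s) \<in> green_L"
    using mult.prems green_L_mult_left_iff[of "u * v" s] by simp
  moreover have "(v * s, s) \<in> green_L"
    using v green_L_mult_left_iff[of v s] by simp
  ultimately have "(u * (v * s), v * s) \<in> green_L"
    by (simp add: green_L_def mult.assoc)
  then have "star u * u * (v * s) = v * s"
    by (simp add: green_L_mult_left_iff)
  then obtain n where "path F n (v * s) (u * (v * s))"
    using mult.IH(1) by blast
  moreover obtain m where "path F m s (v * s)"
    using mult.IH(2)[OF v] by blast
  ultimately show ?case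
    using path_trans by (metis mult.assoc)
next
  case (star u)
  \<comment> \<open>The induction hypothesis is used at \<open>star u * s\<close>, which
    \<open>u\<close> leads back to \<open>s\<close>; the resulting path is then reversed.\<close>
  have "u * (star u * s) = s"
    using star.prems by (simp add: mult.assoc)
  moreover have "star u * u * (star u * s) = star u * s"
    by (simp add: mult.assoc star_inverse_assoc)
  ultimately obtain n where "path F n (star u * s) s"
    using star.IH[of "star u * s"] by auto
  then show ?case using path_sym by blast
qed

text \<open>Split off the last edge: it multiplies by one of finitely many generators or their
  inverses, and what remains is shorter by at least 1, so the induction hypothesis covers
  it.\<close>

lemma finite_path_multipliers:
  fixes F :: "'a::inverse_semigroup set"
  assumes "countable F"
  shows "\<exists>W. finite W \<and> (\<forall>m\<le>n. \<forall>x y. path F m x y \<longrightarrow> x \<noteq> y \<longrightarrow> y \<in> (\<lambda>f. f * x) ` W)"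
proof (induction n)
  case 0
  show ?case by (rule exI[of _ "{}"]) (auto dest: path_0_eq)
next
  case (Suc n)
  then obtain W where W: "finite W"
    "\<And>m x y. m \<le> n \<Longrightarrow> path F m x y \<Longrightarrow> x \<noteq> y \<Longrightarrow> y \<in> (\<lambda>f. f * x) ` W"
    by blast
  \<comment> \<open>An edge of length at most \<open>Suc n\<close> has a generator of index at most
    \<open>n\<close>.\<close>
  define G0 where "G0 = {g \<in> F. to_nat_on F g \<le> n}"
  have "finite G0"
  proof (rule finite_imageD)
    show "finite (to_nat_on F ` G0)"
      by (rule finite_subset[of _ "{..n}"]) (auto simp: G0_def)
    show "inj_on (to_nat_on F) G0"
      using inj_on_to_nat_on[OF assms] by (rule inj_on_subset) (auto simp: G0_def)
  qed
  \<comment> \<open>A backward edge leads from \<open>g * y\<close> to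
    \<open>y = star g * (g * y)\<close>, so inverses of generators occur as factors too.\<close>
  define G where "G = G0 \<union> star ` G0"
  have finG: "finite G"
    using \<open>finite G0\<close> by (simp add: G_def)
  \<comment> \<open>\<open>G\<close> alone covers the case that the path returns to \<open>x\<close>
    before its last edge; an identity element need not exist.\<close>
  define V where "V = G \<union> (\<lambda>(g, w). g * w) ` (G \<times> W)"
  have V: "g * t \<in> (\<lambda>f. f * x) ` V" if g: "g \<in> G" and m: "m \<le> n" "path F m x t"
    for g t m x
  proof (cases "x = t")
    case True
    then show ?thesis using g by (auto simp: V_def)
  next
    case False
    then obtain w where "w \<in> W" "t = w * x"
      using W(2)[OF m] by auto
    then have "g * t = (g * w) * x" "g * w \<in> V"
      using g by (auto simp: V_def mult.assoc)
    then show ?thesis by blast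
  qed
  have "y \<in> (\<lambda>f. f * x) ` V" if "path F m x y" "m \<le> Suc n" "x \<noteq> y" for m x y
    using that(1)
  proof cases
    case path_refl
    then show ?thesis using that by simp
  next
    case (path_step k t g)
    then have "g \<in> G" "k \<le> n"
      using that by (auto simp: G_def G0_def)
    then show ?thesis using V path_step by blast
  next
    case (path_back k g)
    then have "star g \<in> G" "k \<le> n"
      using that by (auto simp: G_def G0_def)
    moreover have "y = star g * (g * y)"
      using path_back by (simp add: mult.assoc)
    ultimately show ?thesis using V path_back by metis
  qed
  moreover have "finite V"
    using W(1) finG by (simp add: V_def)
  ultimately show ?case by blast
qed

section \<open>The path distance is an admissible metric\<close>

definition path_dist :: "'a::inverse_semigroup set \<Rightarrow> 'a \<Rightarrow> 'a \<Rightarrow> ennreal"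
  where "path_dist F x y =
    (if \<exists>n. path F n x y then of_nat (LEAST n. path F n x y) else \<infinity>)"

lemma path_dist_le: "path F n x y \<Longrightarrow> path_dist F x y \<le> of_nat n"
  by (auto simp: path_dist_def intro: Least_le)

lemma path_dist_attained:
  assumes "path_dist F x y < \<infinity>"
  obtains n where "path F n x y" "path_dist F x y = of_nat n"
  using assms by (metis path_dist_def LeastI_ex less_irrefl)

lemma extended_metric_path_dist: "extended_metric (path_dist F)"
  unfolding extended_metric_def
proof (intro conjI allI)
  fix x y z
  have "x = y" if "path_dist F x y = 0"
    using that by (metis path_dist_attained path_0_eq of_nat_eq_0_iff infinity_ennreal_def
        ennreal_zero_less_top)
  moreover have "path_dist F x x = 0"
    using path_dist_le[OF path_refl, of F x] by simp
  ultimately show "path_dist F x y = 0 \<longleftrightarrow> x = y" by blast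
  have "path F n x y \<longleftrightarrow> path F n y x" for n
    using path_sym by blast
  then show "path_dist F x y = path_dist F y x"
    by (simp add: path_dist_def)
  show "path_dist F x z \<le> path_dist F x y + path_dist F y z"
  proof (cases "path_dist F x y < \<infinity> \<and> path_dist F y z < \<infinity>")
    case True
    obtain m where m: "path F m x y" "path_dist F x y = of_nat m"
      using True path_dist_attained by blast
    obtain n where n: "path F n y z" "path_dist F y z = of_nat n"
      using True path_dist_attained by blast
    show ?thesis
      using path_dist_le[OF path_trans[OF n(1) m(1)]] m n by simp
  next
    case False
    then show ?thesis by (auto simp: less_top[symmetric])
  qed
qed

lemma uniformly_discrete_path_dist: "uniformly_discrete (path_dist F)"
  unfolding uniformly_discrete_def
proof (intro exI conjI allI impI)
  \<comment> \<open>Distinct points are at distance at least 1; the strict inequality asks for a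
    constant below 1.\<close>
  show "(1/2 :: real) > 0" by simp
  fix x y :: 'a assume "x \<noteq> y"
  show "path_dist F x y > ennreal (1/2)"
  proof (cases "path_dist F x y < \<infinity>")
    case True
    then obtain n where n: "path F n x y" "path_dist F x y = of_nat n"
      by (rule path_dist_attained)
    then have "n \<noteq> 0"
      using \<open>x \<noteq> y\<close> path_0_eq by metis
    then have "ennreal (1/2) < ennreal (real n)"
      by (subst ennreal_less_iff) auto
    then show ?thesis
      by (simp only: n ennreal_of_nat_eq_real_of_nat)
  next
    case False
    then show ?thesis by (simp add: less_top[symmetric])
  qed
qed

text \<open>Paths stay in an L-class. Conversely, for L-related \<open>x\<close> and
  \<open>y\<close> the element \<open>y * star x\<close> carries \<open>x\<close> to
  \<open>y * star y * y = y\<close>, and it is a product of generators.\<close>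

lemma path_dist_finite_iff_green_L:
  assumes "generated (F \<union> idempotents) = UNIV"
  shows "path_dist F x y < \<infinity> \<longleftrightarrow> (x, y) \<in> green_L"
proof
  assume "path_dist F x y < \<infinity>"
  then show "(x, y) \<in> green_L"
    using path_dist_attained path_green_L by metis
next
  assume *: "(x, y) \<in> green_L"
  have "y * star x * x = y"
    using * by (simp add: green_L_def mult.assoc star_inverse_assoc)
  moreover have "(y, x) \<in> green_L"
    using * by (simp add: green_L_def)
  ultimately obtain n where "path F n x y"
    using path_generated[of "y * star x" F x] assms green_L_mult_left_iff[of "y * star x" x]
    by auto
  then show "path_dist F x y < \<infinity>"
    using path_dist_le[of F n x y] by (auto simp: order_le_less_trans of_nat_less_top)
qed

lemma right_subinvariant_path_dist: "right_subinvariant (path_dist F)"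
  unfolding right_subinvariant_def
proof (intro allI)
  fix s t x :: 'a
  show "path_dist F (s * x) (t * x) \<le> path_dist F s t"
  proof (cases "path_dist F s t < \<infinity>")
    case True
    then show ?thesis
      using path_dist_attained path_dist_le path_mult_right by metis
  next
    case False
    then show ?thesis by (simp add: less_top[symmetric])
  qed
qed

lemma proper_path_dist:
  assumes "countable F"
  shows "proper_metric (path_dist F)"
  unfolding proper_metric_def
proof (intro allI impI)
  fix r :: real assume "r \<ge> 0"
  \<comment> \<open>Distances are natural numbers or infinite, so the bound \<open>r\<close> can be
    rounded up to a natural number.\<close>
  obtain W where W: "finite W"
    "\<forall>m\<le>nat \<lceil>r\<rceil>. \<forall>x y. path F m x y \<longrightarrow> x \<noteq> y \<longrightarrow> y \<in> (\<lambda>f. f * x) ` W"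
    using finite_path_multipliers[OF assms] by blast
  have "y \<in> (\<lambda>f. f * x) ` W" if "x \<noteq> y" "path_dist F x y \<le> ennreal r" for x y
  proof -
    have "path_dist F x y < \<infinity>"
      using that(2) by (auto simp: order_le_less_trans)
    then obtain n where n: "path F n x y" "path_dist F x y = of_nat n"
      by (rule path_dist_attained)
    then have "real n \<le> r"
      using that(2) \<open>r \<ge> 0\<close> by (simp add: ennreal_of_nat_eq_real_of_nat)
    then have "n \<le> nat \<lceil>r\<rceil>"
      by linarith
    then show ?thesis using W n that by blast
  qed
  with W(1) show "\<exists>W. finite W \<and> (\<forall>x y. x \<noteq> y \<and> path_dist F x y \<le> ennreal r \<longrightarrow>
      y \<in> (\<lambda>f. f * x) ` W)"
    by blast
qed

lemma admissible_path_dist: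
  assumes "countable F" "generated (F \<union> idempotents) = UNIV"
  shows "admissible_metric (path_dist F)"
proof -
  have "{(x, y). path_dist F x y < \<infinity>} = green_L"
    using path_dist_finite_iff_green_L[OF assms(2)] by auto
  then have "components (path_dist F) = L_classes"
    by (simp add: components_def L_classes_def)
  then show ?thesis
    by (simp add: admissible_metric_def extended_metric_path_dist uniformly_discrete_path_dist
        right_subinvariant_path_dist proper_path_dist assms(1))
qed


section \<open>Admissible metrics\<close>

text \<open>An equivalence relation is recovered from its classes: two points are related iff some
  class contains both. This turns equality of components and L-classes into a pointwise
  statement.\<close>

lemma quotient_eq_imp_equiv_eq:
  assumes R: "equiv A R" and R': "equiv A R'" and eq: "A // R = A // R'"
  shows "R = R'"
proof -
  have "(x, y) \<in> P \<longleftrightarrow> (\<exists>X\<in>A // P. x \<in> X \<and> y \<in> X)" if "equiv A P" for x y P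
  proof
    assume "(x, y) \<in> P"
    moreover from this have "x \<in> A"
      using that by (auto dest: equiv_type)
    ultimately show "\<exists>X\<in>A // P. x \<in> X \<and> y \<in> X"
      using equiv_class_self[OF that] by (auto intro!: bexI[of _ "P `` {x}"] quotientI)
  next
    assume "\<exists>X\<in>A // P. x \<in> X \<and> y \<in> X"
    then show "(x, y) \<in> P"
      using in_quotient_imp_in_rel[OF that] by blast
  qed
  from this[OF R] this[OF R'] eq show ?thesis by auto
qed

lemma admissible_finite_iff_green_L:
  fixes d :: "'a::inverse_semigroup \<Rightarrow> 'a \<Rightarrow> ennreal"
  assumes "admissible_metric d"
  shows "d x y < \<infinity> \<longleftrightarrow> (x, y) \<in> green_L"
proof -
  have d: "d x x = 0" "d x y = d y x" "d x z \<le> d x y + d y z" for x y z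
    using assms unfolding admissible_metric_def extended_metric_def by blast+
  have "d x z < \<infinity>" if "d x y < \<infinity>" "d y z < \<infinity>" for x y z
    using d(3)[of x z y] that by (auto simp: order_le_less_trans)
  then have "equiv UNIV {(x, y). d x y < \<infinity>}"
    unfolding equiv_def refl_on_def sym_def trans_def using d(1,2) by auto
  then have "{(x, y). d x y < \<infinity>} = green_L"
    by (rule quotient_eq_imp_equiv_eq[OF _ equiv_green_L])
      (use assms in \<open>simp add: admissible_metric_def components_def L_classes_def\<close>)
  then show ?thesis by blast
qed

section \<open>From an admissible metric to quasi-countability\<close>

lemma admissible_imp_quasi_countable:
  fixes d :: "'a::inverse_semigroup \<Rightarrow> 'a \<Rightarrow> ennreal"
  assumes d: "admissible_metric d"
  shows "quasi_countable TYPE('a)"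
proof -
  have "\<exists>F. finite F \<and> (\<forall>x y. x \<noteq> y \<and> d x y \<le> ennreal (real n) \<longrightarrow> y \<in> (\<lambda>f. f * x) ` F)" for n
    using d by (simp add: admissible_metric_def proper_metric_def)
  then obtain W where W: "\<And>n. finite (W n)"
    "\<And>n x y. x \<noteq> y \<Longrightarrow> d x y \<le> ennreal (real n) \<Longrightarrow> y \<in> (\<lambda>f. f * x) ` W n"
    by metis
  \<comment> \<open>Natural radii suffice, since every finite distance lies below one; this keeps
    the union countable.\<close>
  define F where "F = (\<Union>n. W n)"
  have "countable F"
    unfolding F_def using W(1) by (auto intro: countable_finite)
  moreover have "s \<in> generated (F \<union> idempotents)" for s
  proof -
    let ?e = "star s * s"
    have e: "?e \<in> idempotents"
      by (simp add: idempotents_def idempotent_star_mult)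
    show ?thesis
    \<comment> \<open>Properness speaks of distinct points only. When both coincide,
      \<open>s\<close> is itself idempotent.\<close>
    proof (cases "?e = s")
      case True
      then show ?thesis using e generated_superset by (metis UnCI subsetD)
    next
      case False
      have "d ?e s < \<infinity>"
        using admissible_finite_iff_green_L[OF d] green_L_star_mult by blast
      then obtain n where "d ?e s \<le> ennreal (real n)"
        by (metis ennreal_of_nat_eq_real_of_nat ennreal_Ex_less_of_nat infinity_ennreal_def
            less_imp_le)
      then obtain f where "f \<in> W n" "s = f * ?e"
        using W(2)[OF False] by blast
      then show ?thesis
        using e generated_superset[of "F \<union> idempotents"] generated_mult[of f _ ?e]
        by (auto simp: F_def)
    qed
  qed
  ultimately show ?thesis
    unfolding quasi_countable_def by blast
qed

section \<open>Uniqueness up to bijective coarse equivalence\<close>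

text \<open>Properness of \<open>d\<close> gives \<open>y = f * x\<close> with \<open>f\<close> from
  a finite set, and right subinvariance of \<open>d'\<close> bounds \<open>d' x (f * x)\<close> by
  \<open>d' (star f * f) f\<close>. Applied in both directions, this yields the two control
  functions.\<close>

lemma admissible_bornologous:
  fixes d d' :: "'a::inverse_semigroup \<Rightarrow> 'a \<Rightarrow> ennreal"
  assumes d: "admissible_metric d" and d': "admissible_metric d'" and "r < \<infinity>"
  obtains C where "C < \<infinity>" "\<And>x y. d x y \<le> r \<Longrightarrow> d' x y \<le> C"
proof -
  obtain r0 where r0: "r = ennreal r0" "r0 \<ge> 0"
    using \<open>r < \<infinity>\<close> by (cases r) auto
  then obtain W where W: "finite W"
    "\<And>x y. x \<noteq> y \<Longrightarrow> d x y \<le> r \<Longrightarrow> y \<in> (\<lambda>f. f * x) ` W"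
    using d unfolding admissible_metric_def proper_metric_def by metis
  have d'_refl: "d' x x = 0" for x
    using d' by (simp add: admissible_metric_def extended_metric_def)
  \<comment> \<open>A sum in place of a maximum also makes sense for empty \<open>W\<close>, and it
    bounds each of its nonnegative terms.\<close>
  define C where "C = (\<Sum>f\<in>W. d' (star f * f) f)"
  have "d' (star f * f) f < top" for f
    using admissible_finite_iff_green_L[OF d'] green_L_star_mult unfolding infinity_ennreal_def
    by blast
  then have "C < \<infinity>"
    using W(1) by (simp add: C_def)
  moreover have "d' x y \<le> C" if dxy: "d x y \<le> r" for x y
  proof (cases "x = y")
    case True
    then show ?thesis by (simp add: d'_refl)
  next
    case False
    then obtain f where f: "f \<in> W" "y = f * x"
      using W(2) dxy by blast
    have "d x y < \<infinity>"
      using dxy \<open>r < \<infinity>\<close> by (rule order_le_less_trans)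
    then have "(x, f * x) \<in> green_L"
      using admissible_finite_iff_green_L[OF d] f(2) by blast
    then have "star f * f * x = x"
      using green_L_mult_left_iff[of f x] by (simp add: green_L_def)
    then have "d' x y = d' (star f * f * x) (f * x)"
      by (simp add: f)
    also have "\<dots> \<le> d' (star f * f) f"
      using d' by (simp add: admissible_metric_def right_subinvariant_def)
    also have "\<dots> \<le> C"
      unfolding C_def using W(1) f(1) by (intro member_le_sum) auto
    finally show ?thesis .
  qed
  ultimately show ?thesis using that by blast
qed

lemma admissible_coarse_embedding_id:
  fixes d d' :: "'a::inverse_semigroup \<Rightarrow> 'a \<Rightarrow> ennreal"
  assumes d: "admissible_metric d" and d': "admissible_metric d'"
  shows "coarse_embedding d d' id"
proof -
  \<comment> \<open>These are the tightest control functions, except that \<open>up\<close> is set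
    to infinity at infinity: the supremum there may be finite, for instance when \<open>S\<close> is
    finite with a single L-class.\<close>
  define up where "up r = (if r = \<infinity> then \<infinity> else (SUP (x, y) \<in> {(x, y). d x y \<le> r}. d' x y))" for r
  define lo where "lo r = (INF (x, y) \<in> {(x, y). r \<le> d x y}. d' x y)" for r
  have "mono lo"
    unfolding lo_def by (intro monoI INF_superset_mono) auto
  moreover have "mono up"
  proof (rule monoI)
    fix r s :: ennreal assume "r \<le> s"
    show "up r \<le> up s"
    proof (cases "s = \<infinity>")
      case False
      with \<open>r \<le> s\<close> have "r \<noteq> \<infinity>" by (auto simp: top_unique)
      with False \<open>r \<le> s\<close> show ?thesis
        unfolding up_def by (auto intro!: SUP_subset_mono)
    qed (simp add: up_def)
  qed
  moreover have "up r \<noteq> \<infinity>" if "r \<noteq> \<infinity>" for r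
  proof -
    have "r < \<infinity>" using that by (simp add: less_top)
    then obtain C where C: "C < \<infinity>" "\<And>x y. d x y \<le> r \<Longrightarrow> d' x y \<le> C"
      using admissible_bornologous[OF d d'] by blast
    have "up r \<le> C"
      using that C(2) by (auto simp: up_def intro!: SUP_least)
    then show ?thesis using C(1) by auto
  qed
  then have "up r = \<infinity> \<longleftrightarrow> r = \<infinity>" for r
    by (metis up_def)
  then have "up -` {\<infinity>} = {\<infinity>}"
    by (simp add: vimage_def)
  moreover have "((\<lambda>r::real. lo (ennreal r)) \<longlongrightarrow> \<infinity>) at_top"
    unfolding infinity_ennreal_def
  proof (rule order_tendstoI)
    fix a :: ennreal assume "a < top"
    \<comment> \<open>The infimum yields only a weak bound \<open>b \<le> lo (ennreal r)\<close>;
      the gap between \<open>a\<close> and \<open>b\<close> makes it strict.\<close>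
    then obtain b where b: "a < b" "b < top"
      using dense by blast
    \<comment> \<open>The metrics swap roles: pairs with \<open>d'\<close> at most \<open>b\<close>
      have \<open>d\<close> at most \<open>C\<close>, so beyond \<open>C\<close> the value of
      \<open>d'\<close> exceeds \<open>b\<close>.\<close>
    obtain C where C: "C < \<infinity>" "\<And>x y. d' x y \<le> b \<Longrightarrow> d x y \<le> C"
      using admissible_bornologous[OF d' d, of b] b by auto
    then obtain c where c: "C = ennreal c" "c \<ge> 0"
      by (cases C) auto
    have "a < lo (ennreal r)" if "c < r" for r
    proof -
      have "b \<le> lo (ennreal r)"
        unfolding lo_def
      proof (rule INF_greatest, clarify)
        fix x y assume "ennreal r \<le> d x y"
        moreover have "C < ennreal r"
          using c that by (simp add: ennreal_less_iff)
        ultimately have "\<not> d x y \<le> C" by auto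
        then show "b \<le> d' x y" using C(2) by force
      qed
      with b show ?thesis by simp
    qed
    then show "\<forall>\<^sub>F r in at_top. a < lo (ennreal r)"
      by (rule eventually_mono[OF eventually_gt_at_top])
  qed auto
  moreover have "lo (d x y) \<le> d' (id x) (id y)" "d' (id x) (id y) \<le> up (d x y)" for x y
    by (auto simp: lo_def up_def intro: INF_lower2[of "(x, y)"] SUP_upper2[of "(x, y)"])
  ultimately show ?thesis
    unfolding coarse_embedding_def by blast
qed

lemma admissible_bijective_coarse_equivalence_id:
  fixes d d' :: "'a::inverse_semigroup \<Rightarrow> 'a \<Rightarrow> ennreal"
  assumes d: "admissible_metric d" and d': "admissible_metric d'"
  shows "bijective_coarse_equivalence d d' id"
proof -
  have "d' x x = 0" for x
    using d' by (simp add: admissible_metric_def extended_metric_def)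
  \<comment> \<open>The identity is surjective, so radius 0 already covers everything.\<close>
  then have "neighbourhood d' 0 (range id) = UNIV"
    by (auto simp: neighbourhood_def)
  then have "\<exists>k\<ge>0. neighbourhood d' k (range (id :: 'a \<Rightarrow> 'a)) = UNIV"
    by blast
  then show ?thesis
    using admissible_coarse_embedding_id[OF d d']
    unfolding bijective_coarse_equivalence_def coarse_equivalence_def by simp
qed

theorem theorem1:
  shows "(quasi_countable TYPE('a::inverse_semigroup) \<longleftrightarrow>
            (\<exists>d :: 'a \<Rightarrow> 'a \<Rightarrow> ennreal. admissible_metric d)) \<and>
         (\<forall>d d' :: 'a \<Rightarrow> 'a \<Rightarrow> ennreal. admissible_metric d \<longrightarrow> admissible_metric d' \<longrightarrow>
            (\<exists>f :: 'a \<Rightarrow> 'a. bijective_coarse_equivalence d d' f))"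
  using admissible_path_dist admissible_imp_quasi_countable
    admissible_bijective_coarse_equivalence_id
  unfolding quasi_countable_def by metis

end
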